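(* A function $f:[0,1]\to[0,1]$ in $D'[0,1]$ belongs to the interior of $\mathcal{F}$ (in $D'[0,1]$ with the topology of $\|\cdot\|_{1'}$) if and only if: (i) there are two constants $c_1>0$ and $c_2<1$ such that $c_1\le f(x)\le c_2$ for all $x\in[0,1]$; and (ii) for each $x\in(0,1]$, $$\int_x^1\min\{f(y),x\}\,dy+x^2-\int_0^x f(y)\,dy>0 .$$
   Context: $D'[0,1]$ denotes the set of nonincreasing real functions on $[0,1]$ which are left continuous on $(0,1)$. It is endowed with the topology induced by the modified $L^1$ norm $$\|f\|_{1'}:=|f(0)|+|f(1)|+\int_0^1|f(x)|\,dx .$$ The degree sequence of an undirected simple graph on $n$ vertices is the vector of degrees of its vertices. A sequence of degree sequences $\mathbf{d}^n=(d_1^n\ge\cdots\ge d_n^n)$ of simple graphs on $n$ vertices (one for each $n$) has scaling limit $f$, where $f$ is a nonincreasing function on $[0,1]$, if $$\lim_{n\to\infty}\left(\left|\frac{d_1^n}{n}-f(0)\right|+\left|\frac{d_n^n}{n}-f(1)\right|+\frac1n\sum_{i=1}^n\left|\frac{d_i^n}{n}-f\left(\frac in\right)\right|\right)=0 .$$ $\mathcal{F}$ is the set of functions in $D'[0,1]$ that can be obtained as scaling limits, in this sense, of degree sequences of simple graphs. *)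

theory Defs
  imports "HOL-Analysis.Analysis"
begin

definition simple_graph :: "'v set \<Rightarrow> 'v set set \<Rightarrow> bool" where
  "simple_graph V E \<longleftrightarrow> finite V \<and> E \<subseteq> {e. e \<subseteq> V \<and> card e = 2}"

definition vertex_degree :: "'v set set \<Rightarrow> 'v \<Rightarrow> nat" where
  "vertex_degree E v = card {e \<in> E. v \<in> e}"

(* Degree sequences are indexed by the vertices 1..n, listed in nonincreasing order of degree;
   the values of d outside {1..n} are irrelevant. *)
definition degree_sequence :: "nat \<Rightarrow> (nat \<Rightarrow> nat) \<Rightarrow> bool" where
  "degree_sequence n d \<longleftrightarrow>
     antimono_on {1..n} d \<and>
     (\<exists>E. simple_graph {1..n} E \<and> (\<forall>i\<in>{1..n}. d i = vertex_degree E i))"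

(* Functions on [0,1] are represented extensionally (undefined outside [0,1]),
   so that equality in D_space is equality on [0,1]. *)
definition D_space :: "(real \<Rightarrow> real) set" where
  "D_space = {f \<in> extensional {0..1}. antimono_on {0..1} f \<and>
     (\<forall>x\<in>{0<..<1}. continuous (at_left x) f)}"

definition norm1' :: "(real \<Rightarrow> real) \<Rightarrow> real" where
  "norm1' f = \<bar>f 0\<bar> + \<bar>f 1\<bar> + integral {0..1} (\<lambda>x. \<bar>f x\<bar>)"

definition dist1' :: "(real \<Rightarrow> real) \<Rightarrow> (real \<Rightarrow> real) \<Rightarrow> real" where
  "dist1' f g = norm1' (\<lambda>x. f x - g x)"

definition D_topology :: "(real \<Rightarrow> real) topology" where
  "D_topology = Metric_space.mtopology D_space dist1'"

definition has_scaling_limit :: "(nat \<Rightarrow> nat \<Rightarrow> nat) \<Rightarrow> (real \<Rightarrow> real) \<Rightarrow> bool" where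
  "has_scaling_limit d f \<longleftrightarrow>
     (\<lambda>n. \<bar>real (d n 1) / real n - f 0\<bar> + \<bar>real (d n n) / real n - f 1\<bar>
        + (1 / real n) * (\<Sum>i=1..n. \<bar>real (d n i) / real n - f (real i / real n)\<bar>))
     \<longlonglongrightarrow> 0"

definition scaling_limits :: "(real \<Rightarrow> real) set" where
  "scaling_limits =
     {f \<in> D_space. \<exists>d. (\<forall>n. degree_sequence n (d n)) \<and> has_scaling_limit d f}"

lemma D_space_integrable:
  assumes "f \<in> D_space"
  shows "integrable (lebesgue_on {0..1}) f"
proof -
  have "mono_on {0..1} (\<lambda>x. - f x)"
    using assms by (auto simp: D_space_def monotone_on_def)
  then have "integrable (lebesgue_on {0..1}) (\<lambda>x. - f x)"
    by (rule integrable_mono_on)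
  then show ?thesis
    by simp
qed

lemma D_space_abs_diff_integrable:
  assumes "f \<in> D_space" "g \<in> D_space"
  shows "(\<lambda>x. \<bar>f x - g x\<bar>) integrable_on {0..1}"
  using assms by (intro integrable_on_lebesgue_on integrable_abs
      Bochner_Integration.integrable_diff D_space_integrable) auto

lemma dist1'_eq_0:
  assumes f: "f \<in> D_space" and g: "g \<in> D_space" and 0: "dist1' f g = 0"
  shows "f = g"
proof -
  define h where "h = (\<lambda>x. \<bar>f x - g x\<bar>)"
  have hint: "h integrable_on {0..1}"
    unfolding h_def using f g by (rule D_space_abs_diff_integrable)
  have "integral {0..1} h \<ge> 0"
    by (rule Henstock_Kurzweil_Integration.integral_nonneg[OF hint]) (simp add: h_def)
  then have end0: "f 0 = g 0" "f 1 = g 1" and int0: "integral {0..1} h = 0"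
    using 0 by (auto simp: dist1'_def norm1'_def h_def)
  have inner: "f x = g x" if x: "x \<in> {0<..<1}" for x
  proof (rule ccontr)
    assume "f x \<noteq> g x"
    then have pos: "h x > 0"
      by (simp add: h_def)
    have "continuous (at_left x) h"
      unfolding h_def using f g x by (intro continuous_intros) (auto simp: D_space_def)
    then have "(h \<longlongrightarrow> h x) (at_left x)"
      by (simp add: continuous_within)
    then have "\<forall>\<^sub>F y in at_left x. h y > h x / 2"
      using pos by (intro order_tendstoD) auto
    then obtain b where b: "b < x" "\<And>y. b < y \<Longrightarrow> y < x \<Longrightarrow> h y > h x / 2"
      using eventually_at_left_real[of 0 x] x unfolding eventually_at_left_field by blast
    define a where "a = (max b 0 + x) / 2"
    have a: "b < a" "0 < a" "a < x"
      using b(1) x by (auto simp: a_def max_def)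
    have sub: "{a..x} \<subseteq> {0..1}"
      using a x by auto
    have ge: "h y \<ge> h x / 2" if "y \<in> {a..x}" for y
      using that b(2)[of y] a pos by (cases "y = x") auto
    have hint': "h integrable_on {a..x}"
      using integrable_on_subinterval[OF hint sub] .
    have "0 < (x - a) * (h x / 2)"
      using a pos by simp
    also have "\<dots> = integral {a..x} (\<lambda>_. h x / 2)"
      using a by simp
    also have "\<dots> \<le> integral {a..x} h"
      using ge hint' by (intro integral_le) auto
    also have "\<dots> \<le> integral {0..1} h"
      by (rule integral_subset_le[OF sub hint' hint]) (simp add: h_def)
    finally show False
      using int0 by simp
  qed
  show ?thesis
  proof (rule extensionalityI)
    show "f \<in> extensional {0..1}" "g \<in> extensional {0..1}"
      using f g by (auto simp: D_space_def)
    show "f x = g x" if "x \<in> {0..1}" for x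
      using that end0 inner[of x] by (cases "x = 0 \<or> x = 1") auto
  qed
qed

lemma Metric_space_D_space: "Metric_space D_space dist1'"
proof
  fix f g :: "real \<Rightarrow> real"
  show "0 \<le> dist1' f g"
  proof (cases "(\<lambda>x. \<bar>f x - g x\<bar>) integrable_on {0..1}")
    case True
    then have "integral {0..1} (\<lambda>x. \<bar>f x - g x\<bar>) \<ge> 0"
      by (rule Henstock_Kurzweil_Integration.integral_nonneg) simp
    then show ?thesis
      by (simp add: dist1'_def norm1'_def)
  next
    case False
    then show ?thesis
      by (simp add: dist1'_def norm1'_def not_integrable_integral)
  qed
  show "dist1' f g = dist1' g f"
    by (simp add: dist1'_def norm1'_def abs_minus_commute)
next
  fix f g assume "f \<in> D_space" "g \<in> D_space"
  then show "dist1' f g = 0 \<longleftrightarrow> f = g"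
    using dist1'_eq_0 by (auto simp: dist1'_def norm1'_def)
next
  fix f g k assume *: "f \<in> D_space" "g \<in> D_space" "k \<in> D_space"
  have "integral {0..1} (\<lambda>x. \<bar>f x - k x\<bar>)
      \<le> integral {0..1} (\<lambda>x. \<bar>f x - g x\<bar> + \<bar>g x - k x\<bar>)"
    using * by (intro integral_le integrable_add D_space_abs_diff_integrable) auto
  also have "\<dots> = integral {0..1} (\<lambda>x. \<bar>f x - g x\<bar>) + integral {0..1} (\<lambda>x. \<bar>g x - k x\<bar>)"
    using * by (intro Henstock_Kurzweil_Integration.integral_add D_space_abs_diff_integrable)
  finally show "dist1' f k \<le> dist1' f g + dist1' g k"
    unfolding dist1'_def norm1'_def by linarith
qed

lemma topspace_D_topology: "topspace D_topology = D_space"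
  unfolding D_topology_def by (rule Metric_space.topspace_mtopology[OF Metric_space_D_space])

end

theory Submission
  imports Defs
begin

text \<open>
The function \<open>eg_gap f x\<close> of condition (ii) is what the Erdos-Gallai inequalities become in the
scaling limit: with \<open>k = n x\<close> and degrees \<open>d i \<approx> n f (i / n)\<close>, the inequality
\<open>(\<Sum>i\<le>k. d i) \<le> k * (k - 1) + (\<Sum>i>k. min (d i) k)\<close> divided by \<open>n\<^sup>2\<close> is \<open>0 \<le> eg_gap f x\<close> up to an error
that is small uniformly in \<open>k\<close> (\<open>eg_slack_approx\<close>). Hence every scaling limit has values in \<open>[0,1]\<close>
and a nonnegative gap (\<open>scaling_limits_bounds\<close>, \<open>eg_gap_nonneg\<close>).

These inequalities become strict at interior points, since each can be violated by a small
perturbation when it is an equality: shifting \<open>f\<close> by a constant moves the end values, and raising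
\<open>f\<close> by \<open>c\<close> on \<open>[0,x]\<close> lowers the gap at \<open>x\<close> by \<open>c * x\<close> (\<open>interior_scaling_limitsD\<close>).

Conversely, the strict inequalities make \<open>f\<close> a scaling limit: round \<open>n f (i / n)\<close> to integers with
even sum and apply the Erdos-Gallai theorem (\<open>scaling_limits_if_gap_pos\<close>). The delicate point is that
\<open>eg_gap f x\<close> tends to 0 as \<open>x\<close> tends to 0, so that small \<open>k\<close> need a separate argument. This is the
purpose of the bounds \<open>c1 \<le> f \<le> c2\<close>: for \<open>x \<le> c1\<close> every \<open>min (f y) x\<close> is \<open>x\<close>, and the gap is at least
\<open>(1 - c2) * x\<close>, with a discrete analogue (\<open>eg_gap_near_0\<close>, \<open>eg_slack_sample\<close>); for \<open>x\<close> away from 0,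
compactness gives a uniform positive lower bound (\<open>eg_gap_bounded_below\<close>). Both the bounds and the
lower estimate survive small perturbations of \<open>f\<close> (\<open>eg_gap_dist\<close>), so a whole neighbourhood of \<open>f\<close>
consists of scaling limits (\<open>interior_scaling_limitsI\<close>).

The sufficiency half of the Erdos-Gallai theorem (\<open>erdos_gallai_sufficient\<close>) is proved by
completing the vertices one at a time through edge exchanges (\<open>partial_realization_improve\<close>).
\<close>

section \<open>Degrees and neighbourhoods\<close>

definition neighbours :: "'v set set \<Rightarrow> 'v \<Rightarrow> 'v set" where
  "neighbours E v = {u. {u, v} \<in> E}"

lemma simple_graph_edgeD:
  assumes "simple_graph V E" "{u, v} \<in> E"
  shows "u \<in> V" "v \<in> V" "u \<noteq> v"
  using assms by (auto simp: simple_graph_def)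

lemma simple_graph_finite_edges: "simple_graph V E \<Longrightarrow> finite E"
  by (auto simp: simple_graph_def intro: finite_subset[of _ "Pow V"])

lemma neighbours_subset: "simple_graph V E \<Longrightarrow> neighbours E v \<subseteq> V - {v}"
  by (auto simp: neighbours_def dest: simple_graph_edgeD)

lemma finite_neighbours: "simple_graph V E \<Longrightarrow> finite (neighbours E v)"
  using neighbours_subset[of V E v] by (auto simp: simple_graph_def intro: finite_subset)

lemma vertex_degree_eq_card_neighbours:
  assumes "simple_graph V E"
  shows "vertex_degree E v = card (neighbours E v)"
proof -
  have "bij_betw (\<lambda>u. {u, v}) (neighbours E v) {e \<in> E. v \<in> e}"
  proof (rule bij_betwI')
    fix e assume "e \<in> {e \<in> E. v \<in> e}"
    then have e: "e \<in> E" "v \<in> e" "card e = 2"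
      using assms by (auto simp: simple_graph_def)
    then obtain u where "e = {u, v}"
      by (auto simp: card_2_iff)
    with e show "\<exists>u\<in>neighbours E v. e = {u, v}"
      by (auto simp: neighbours_def)
  qed (auto simp: neighbours_def doubleton_eq_iff)
  then show ?thesis
    by (simp add: vertex_degree_def bij_betw_same_card)
qed

lemma even_sum_vertex_degree:
  assumes "simple_graph V E"
  shows "even (\<Sum>v\<in>V. vertex_degree E v)"
proof -
  have fin: "finite V" "finite E"
    using assms simple_graph_finite_edges by (auto simp: simple_graph_def)
  have "(\<Sum>v\<in>V. vertex_degree E v) = (\<Sum>v\<in>V. \<Sum>e\<in>E. of_bool (v \<in> e))"
    using fin by (simp add: vertex_degree_def sum_of_bool_eq Int_def)
  also have "\<dots> = (\<Sum>e\<in>E. \<Sum>v\<in>V. of_bool (v \<in> e))"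
    by (rule sum.swap)
  also have "\<dots> = (\<Sum>e\<in>E. 2)"
  proof (rule sum.cong)
    fix e assume "e \<in> E"
    then have e: "e \<subseteq> V" "card e = 2"
      using assms by (auto simp: simple_graph_def)
    then have "V \<inter> {v. v \<in> e} = e" by auto
    with e fin show "(\<Sum>v\<in>V. of_bool (v \<in> e)) = (2::nat)"
      by (simp add: sum_of_bool_eq)
  qed simp
  finally show ?thesis by simp
qed

text \<open>
Split the neighbours of each vertex of \<open>A\<close> into those inside and those outside \<open>A\<close>, and
count the edges leaving \<open>A\<close> from their outer ends. Both directions of the Erdos-Gallai theorem
are read off from this count: necessity bounds the two sums, sufficiency uses a graph in which
both sums are as large as they can be.
\<close>
lemma sum_vertex_degree_split:
  assumes G: "simple_graph V E" and "A \<subseteq> V"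
  shows "(\<Sum>i\<in>A. vertex_degree E i) =
    (\<Sum>i\<in>A. card (neighbours E i \<inter> A)) + (\<Sum>k\<in>V - A. card (neighbours E k \<inter> A))"
proof -
  have fin: "finite V" "finite A"
    using assms finite_subset by (auto simp: simple_graph_def)
  have "(\<Sum>i\<in>A. vertex_degree E i) =
      (\<Sum>i\<in>A. card (neighbours E i \<inter> A) + card (neighbours E i \<inter> (V - A)))"
  proof (rule sum.cong)
    fix i
    have "neighbours E i = (neighbours E i \<inter> A) \<union> (neighbours E i \<inter> (V - A))"
      using neighbours_subset[OF G, of i] by auto
    moreover have "card \<dots> = card (neighbours E i \<inter> A) + card (neighbours E i \<inter> (V - A))"
      using finite_neighbours[OF G] by (intro card_Un_disjoint) auto
    ultimately show "vertex_degree E i =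
        card (neighbours E i \<inter> A) + card (neighbours E i \<inter> (V - A))"
      by (simp add: vertex_degree_eq_card_neighbours[OF G])
  qed simp
  also have "\<dots> = (\<Sum>i\<in>A. card (neighbours E i \<inter> A)) +
      (\<Sum>i\<in>A. card (neighbours E i \<inter> (V - A)))"
    by (rule sum.distrib)
  also have "(\<Sum>i\<in>A. card (neighbours E i \<inter> (V - A))) =
      (\<Sum>i\<in>A. \<Sum>k\<in>V - A. of_bool ({i, k} \<in> E))"
    using fin by (simp add: sum_of_bool_eq neighbours_def Int_def conj_commute insert_commute)
  also have "\<dots> = (\<Sum>k\<in>V - A. \<Sum>i\<in>A. of_bool ({i, k} \<in> E))"
    by (rule sum.swap)
  also have "\<dots> = (\<Sum>k\<in>V - A. card (neighbours E k \<inter> A))"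
    using fin by (simp add: sum_of_bool_eq neighbours_def Int_def conj_commute)
  finally show ?thesis .
qed

section \<open>The Erdos-Gallai theorem\<close>

lemma erdos_gallai_necessary:
  assumes G: "simple_graph {1..n} E" and k: "k \<le> n"
  shows "(\<Sum>i=1..k. vertex_degree E i) \<le>
    k * (k - 1) + (\<Sum>i=k+1..n. min (vertex_degree E i) k)"
proof -
  have V: "{1..n} - {1..k} = {k+1..n}" using k by auto
  have "card (neighbours E i \<inter> {1..k}) \<le> k - 1" if "i \<in> {1..k}" for i
  proof -
    have "card (neighbours E i \<inter> {1..k}) \<le> card ({1..k} - {i})"
      using neighbours_subset[OF G, of i] by (intro card_mono) auto
    then show ?thesis using that by simp
  qed
  then have "(\<Sum>i=1..k. card (neighbours E i \<inter> {1..k})) \<le> k * (k - 1)"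
    using sum_bounded_above[of "{1..k}" "\<lambda>i. card (neighbours E i \<inter> {1..k})" "k - 1"] by simp
  moreover have "(\<Sum>i=k+1..n. card (neighbours E i \<inter> {1..k})) \<le>
      (\<Sum>i=k+1..n. min (vertex_degree E i) k)"
  proof (rule sum_mono)
    fix i
    have "card (neighbours E i \<inter> {1..k}) \<le> card (neighbours E i)"
      using finite_neighbours[OF G] by (intro card_mono) auto
    moreover have "card (neighbours E i \<inter> {1..k}) \<le> card {1..k}"
      by (intro card_mono) auto
    ultimately show "card (neighbours E i \<inter> {1..k}) \<le> min (vertex_degree E i) k"
      by (simp add: vertex_degree_eq_card_neighbours[OF G])
  qed
  ultimately show ?thesis
    using sum_vertex_degree_split[OF G, of "{1..k}"] k unfolding V by auto
qed

text \<open>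
The invariant of the construction of Tripathi, Venugopalan and West: the vertices before \<open>r\<close> have
reached their target degree, no vertex exceeds its target, and the vertices after \<open>r\<close> are pairwise
nonadjacent. The last clause is what turns the final estimate into an equality, because all edges
at a vertex after \<open>r\<close> then end in \<open>{1..r}\<close>.
\<close>
definition partial_realization ::
  "nat \<Rightarrow> (nat \<Rightarrow> nat) \<Rightarrow> nat \<Rightarrow> nat set set \<Rightarrow> bool" where
  "partial_realization n d r E \<longleftrightarrow> simple_graph {1..n} E \<and>
     (\<forall>i\<in>{1..n}. vertex_degree E i \<le> d i) \<and>
     (\<forall>i\<in>{1..<r}. vertex_degree E i = d i) \<and>
     (\<forall>i j. r < i \<longrightarrow> r < j \<longrightarrow> {i, j} \<notin> E)"

lemma vertex_degree_exchange:
  assumes "finite E" "finite A" "R \<subseteq> E" "A \<inter> E = {}"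
  shows "vertex_degree (E - R \<union> A) v + vertex_degree R v = vertex_degree E v + vertex_degree A v"
proof -
  have fin: "finite {e \<in> S. v \<in> e}" if "finite S" for S :: "'a set set"
    using that by simp
  have finR: "finite R" using assms finite_subset by blast
  have 1: "{e \<in> E. v \<in> e} = {e \<in> E - R. v \<in> e} \<union> {e \<in> R. v \<in> e}"
    using assms by auto
  have "vertex_degree E v = vertex_degree (E - R) v + vertex_degree R v"
    unfolding vertex_degree_def by (subst 1, rule card_Un_disjoint) (use assms finR in auto)
  moreover have 2: "{e \<in> E - R \<union> A. v \<in> e} = {e \<in> E - R. v \<in> e} \<union> {e \<in> A. v \<in> e}"
    by auto
  have "vertex_degree (E - R \<union> A) v = vertex_degree (E - R) v + vertex_degree A v"
    unfolding vertex_degree_def by (subst 2, rule card_Un_disjoint) (use assms in auto)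
  ultimately show ?thesis by simp
qed

lemma vertex_degree_singleton: "vertex_degree {e} v = of_bool (v \<in> e)"
proof -
  have "{x. x = e \<and> v \<in> x} = (if v \<in> e then {e} else {})" by auto
  then show ?thesis by (simp add: vertex_degree_def)
qed

lemma vertex_degree_empty: "vertex_degree {} v = 0"
  by (simp add: vertex_degree_def)

lemma vertex_degree_doubleton:
  assumes "e \<noteq> e'"
  shows "vertex_degree {e, e'} v = of_bool (v \<in> e) + of_bool (v \<in> e')"
proof -
  have "{x. (x = e \<or> x = e') \<and> v \<in> x} = (if v \<in> e then {e} else {}) \<union> (if v \<in> e' then {e'} else {})"
    by auto
  then show ?thesis using assms by (simp add: vertex_degree_def)
qed

lemmas vertex_degree_small = vertex_degree_empty vertex_degree_singleton vertex_degree_doubleton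

text \<open>
The only way in which the graph is ever modified: remove the edges \<open>R\<close> and add the edges \<open>A\<close>. The
hypotheses say precisely that the invariant survives and that vertex \<open>r\<close> gains an edge.
\<close>
lemma partial_realization_exchange:
  assumes P: "partial_realization n d r E" and r: "r \<in> {1..n}"
    and R: "R \<subseteq> E" and A: "finite A" "A \<inter> E = {}"
    and new: "\<And>e. e \<in> A \<Longrightarrow> e \<subseteq> {1..n} \<and> card e = 2 \<and> (\<exists>a\<in>e. a \<le> r)"
    and low: "\<And>i. i \<in> {1..<r} \<Longrightarrow> vertex_degree A i = vertex_degree R i"
    and high: "\<And>i. i \<in> {r..n} \<Longrightarrow> vertex_degree E i + vertex_degree A i \<le> d i + vertex_degree R i"
    and gain: "vertex_degree R r < vertex_degree A r"
  shows "\<exists>E'. partial_realization n d r E' \<and> vertex_degree E r < vertex_degree E' r"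
proof (intro exI conjI)
  let ?E = "E - R \<union> A"
  have G: "simple_graph {1..n} E" using P by (simp add: partial_realization_def)
  note x = vertex_degree_exchange[OF simple_graph_finite_edges[OF G] A(1) R A(2)]
  show "vertex_degree E r < vertex_degree ?E r"
    using x[of r] gain by linarith
  have "simple_graph {1..n} ?E"
    using G new unfolding simple_graph_def by fastforce
  moreover have low': "vertex_degree ?E i = d i" if "i \<in> {1..<r}" for i
    using that P low[OF that] x[of i] by (auto simp: partial_realization_def)
  moreover have "vertex_degree ?E i \<le> d i" if i: "i \<in> {1..n}" for i
  proof (cases "i < r")
    case False
    then show ?thesis using high[of i] x[of i] i by simp
  qed (use i low' in auto)
  moreover have "{i, j} \<notin> ?E" if ij: "r < i" "r < j" for i j
  proof
    assume "{i, j} \<in> ?E"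
    then have "{i, j} \<in> A" using ij P by (auto simp: partial_realization_def)
    then show False using new ij by fastforce
  qed
  ultimately show "partial_realization n d r ?E"
    by (auto simp: partial_realization_def)
qed

text \<open>
The case \<open>v\<close> adjacent to \<open>w\<close> is harmless: then each is a neighbour of the other, so removing these
two does not affect the comparison of the degrees.
\<close>
lemma obtain_private_neighbour:
  assumes G: "simple_graph V E" and less: "vertex_degree E v < vertex_degree E w"
  obtains u where "{u, w} \<in> E" "{u, v} \<notin> E" "u \<noteq> v"
proof -
  have "card (neighbours E v) < card (neighbours E w)"
    using less by (simp add: vertex_degree_eq_card_neighbours[OF G])
  moreover have "finite (neighbours E v)" "finite (neighbours E w)"
    using finite_neighbours[OF G] by auto
  moreover have "v \<notin> neighbours E v" "w \<notin> neighbours E w"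
    using neighbours_subset[OF G] by auto
  moreover have "w \<in> neighbours E v \<longleftrightarrow> v \<in> neighbours E w"
    by (simp add: neighbours_def insert_commute)
  ultimately have "card (neighbours E v - {w}) < card (neighbours E w - {v})"
    using card_Suc_Diff1[of "neighbours E v" w] card_Suc_Diff1[of "neighbours E w" v]
    by (cases "v \<in> neighbours E w") auto
  then have "\<not> neighbours E w - {v} \<subseteq> neighbours E v - {w}"
    using \<open>finite (neighbours E v)\<close> by (meson card_mono finite_Diff leD)
  then obtain u where "u \<in> neighbours E w - {v}" "u \<notin> neighbours E v - {w}" by blast
  with \<open>w \<notin> neighbours E w\<close> show ?thesis
    by (intro that[of u]) (auto simp: neighbours_def)
qed

text \<open>
Suppose that no exchange raises the degree of \<open>r\<close>. Each exchange that is available in principle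
then forces some edge to be present already: \<open>r\<close> is adjacent to every later vertex that still
lacks edges and to every earlier vertex, the earlier vertices form a clique, and a later vertex
that lacks edges is adjacent to all of \<open>{1..r}\<close>. Hence \<open>{1..r}\<close> is a clique and every \<open>k > r\<close> has
\<open>min (d k) r\<close> neighbours in it, so the degrees of \<open>{1..r}\<close> add up to the right-hand side of the
Erdos-Gallai inequality although \<open>r\<close> lacks an edge, which contradicts that inequality.

The exchanges use a neighbour \<open>u\<close> of an earlier vertex \<open>i\<close> that is not a neighbour of \<open>r\<close>; it
exists because \<open>i\<close>, whose degree is \<open>d i \<ge> d r\<close>, has larger degree than \<open>r\<close>.
\<close>
lemma partial_realization_improve:
  assumes mono: "antimono_on {1..n} d" and parity: "even (\<Sum>i=1..n. d i)"
    and eg: "(\<Sum>i=1..r. d i) \<le> r * (r - 1) + (\<Sum>i=r+1..n. min (d i) r)"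
    and P: "partial_realization n d r E" and r: "r \<in> {1..n}"
    and deficient: "vertex_degree E r < d r"
  shows "\<exists>E'. partial_realization n d r E' \<and> vertex_degree E r < vertex_degree E' r"
proof (rule ccontr)
  assume stuck: "\<not> ?thesis"
  \<comment> \<open>No admissible exchange raises the degree of \<open>r\<close>; the contradictions below name one.\<close>
  have exch: False if "R \<subseteq> E" "finite A" "A \<inter> E = {}"
    "\<And>e. e \<in> A \<Longrightarrow> e \<subseteq> {1..n} \<and> card e = 2 \<and> (\<exists>a\<in>e. a \<le> r)"
    "\<And>i. i \<in> {1..<r} \<Longrightarrow> vertex_degree A i = vertex_degree R i"
    "\<And>i. i \<in> {r..n} \<Longrightarrow> vertex_degree E i + vertex_degree A i \<le> d i + vertex_degree R i"
    "vertex_degree R r < vertex_degree A r" for R A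
    using partial_realization_exchange[OF P r that] stuck by blast
  have G: "simple_graph {1..n} E" and le: "\<And>i. i \<in> {1..n} \<Longrightarrow> vertex_degree E i \<le> d i"
    and sat: "\<And>i. i \<in> {1..<r} \<Longrightarrow> vertex_degree E i = d i"
    and ind: "\<And>i j. r < i \<Longrightarrow> r < j \<Longrightarrow> {i, j} \<notin> E"
    using P by (auto simp: partial_realization_def)
  have le': "vertex_degree E i \<le> d i" if "i \<in> {r..n}" for i
    using le[of i] that r by simp
  have E: "a \<in> {1..n}" "b \<in> {1..n}" "a \<noteq> b" if "{a, b} \<in> E" for a b
    using simple_graph_edgeD[OF G that] by auto
  have bigger: "vertex_degree E r < vertex_degree E i" if "i \<in> {1..<r}" for i
    using sat[OF that] that deficient r mono monotone_onD[OF mono, of i r] by simp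
  have c0: "{k, r} \<in> E" if k: "k \<in> {r<..n}" "vertex_degree E k < d k" for k
  proof (rule ccontr)
    assume "{k, r} \<notin> E"
    then show False
      using k r deficient by (intro exch[of "{}" "{{r, k}}"])
        (auto simp: vertex_degree_small le' card_insert_if insert_commute)
  qed
  have c1: "{i, r} \<in> E" if i: "i \<in> {1..<r}" for i
  proof (rule ccontr)
    assume ir: "{i, r} \<notin> E"
    obtain u where u: "{u, i} \<in> E" "{u, r} \<notin> E" "u \<noteq> r"
      using obtain_private_neighbour[OF G bigger[OF i]] .
    have distinct: "u \<noteq> i" "i \<noteq> r" "u \<in> {1..n}"
      using E[OF u(1)] i by auto
    then have ne: "{u, r} \<noteq> {i, r}" by (auto simp: doubleton_eq_iff)
    show False
    \<comment> \<open>Replacing \<open>ui\<close> by \<open>ur\<close> and \<open>ir\<close> raises the degree of \<open>r\<close> by 2, which may be one too many.\<close>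
    proof (cases "vertex_degree E r + 2 \<le> d r")
      case True
      show ?thesis
        using True u ir i r distinct ne le[of u] 
        by (intro exch[of "{{u, i}}" "{{u, r}, {i, r}}"])
           (auto simp: vertex_degree_small le le' card_insert_if insert_commute)
    next
      case False
      \<comment> \<open>If \<open>r\<close> lacks exactly one edge, parity yields a later vertex \<open>k\<close> that lacks one too; removing \<open>kr\<close> as well makes room.\<close>
      have "\<exists>k\<in>{r<..n}. vertex_degree E k < d k"
      proof (rule ccontr)
        assume none: "\<not> ?thesis"
        have "vertex_degree E i + of_bool (i = r) = d i" if "i \<in> {1..n}" for i
        proof (cases i r rule: linorder_cases)
          case greater
          then show ?thesis using that none le[of i] by (force intro: le_antisym simp: not_less)
        qed (use that sat[of i] False deficient in auto)
        then have "(\<Sum>i=1..n. vertex_degree E i + of_bool (i = r)) = (\<Sum>i=1..n. d i)"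
          by (intro sum.cong) auto
        moreover have "(\<Sum>i=1..n. of_bool (i = r)) = (1::nat)"
          using r by simp
        ultimately have "(\<Sum>i=1..n. d i) = (\<Sum>i=1..n. vertex_degree E i) + 1"
          by (simp add: sum.distrib)
        with even_sum_vertex_degree[OF G] parity show False by simp
      qed
      then obtain k where k: "k \<in> {r<..n}" "vertex_degree E k < d k" by blast
      have kr: "{k, r} \<in> E" using c0[OF k] .
      with u have "k \<noteq> u" by auto
      then have "{k, r} \<noteq> {u, i}" using k i u by (auto simp: doubleton_eq_iff)
      then show ?thesis
        using u ir i r distinct ne kr k deficient \<open>k \<noteq> u\<close>
        by (intro exch[of "{{k, r}, {u, i}}" "{{u, r}, {i, r}}"])
           (auto simp: vertex_degree_small le le' card_insert_if insert_commute)
    qed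
  qed
  have low: "{i, j} \<in> E" if ij: "i < j" "i \<in> {1..<r}" "j \<in> {1..<r}" for i j
  proof (rule ccontr)
    assume nij: "{i, j} \<notin> E"
    obtain u where u: "{u, i} \<in> E" "{u, r} \<notin> E" "u \<noteq> r"
      using obtain_private_neighbour[OF G bigger[OF ij(2)]] .
    obtain w where w: "{w, j} \<in> E" "{w, r} \<notin> E" "w \<noteq> r"
      using obtain_private_neighbour[OF G bigger[OF ij(3)]] .
    have *: "r < u" "r < w" "u \<le> n" "w \<le> n" using E[OF u(1)] E[OF w(1)] u w c1[of u] c1[of w]
      by (metis atLeastAtMost_iff atLeastLessThan_iff linorder_neqE_nat)+
    have ne: "{u, i} \<noteq> {w, j}" "{i, j} \<noteq> {u, r}" using ij * by (auto simp: doubleton_eq_iff)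
    note degs = vertex_degree_doubleton[OF ne(1)] vertex_degree_doubleton[OF ne(2)]
    \<comment> \<open>The second removed edge \<open>wj\<close> compensates \<open>j\<close> for the new edge \<open>ij\<close>; the case \<open>u = w\<close> is allowed.\<close>
    show False
    proof (rule exch[of "{{u, i}, {w, j}}" "{{i, j}, {u, r}}"])
      show "{{u, i}, {w, j}} \<subseteq> E" using u w by simp
      show "{{i, j}, {u, r}} \<inter> E = {}" using u nij by simp
      show "e \<subseteq> {1..n} \<and> card e = 2 \<and> (\<exists>a\<in>e. a \<le> r)" if "e \<in> {{i, j}, {u, r}}" for e
        using that ij * r by (auto simp: card_insert_if)
      show "vertex_degree {{i, j}, {u, r}} x = vertex_degree {{u, i}, {w, j}} x" if "x \<in> {1..<r}" for x
        using that ij * by (simp add: degs)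
      show "vertex_degree E x + vertex_degree {{i, j}, {u, r}} x \<le> d x + vertex_degree {{u, i}, {w, j}} x"
        if "x \<in> {r..n}" for x
        using that le'[OF that] deficient ij * by (cases "x = r") (simp_all add: degs)
      show "vertex_degree {{u, i}, {w, j}} r < vertex_degree {{i, j}, {u, r}} r"
        using ij * by (simp add: degs)
    qed simp
  qed
  have nbr_low: "neighbours E k \<subseteq> {1..r}" if k: "k \<in> {r<..n}" for k
  proof
    fix u assume "u \<in> neighbours E k"
    then have "{u, k} \<in> E" by (simp add: neighbours_def)
    then show "u \<in> {1..r}"
      using ind[of u k] E(1)[of u k] k by (cases "r < u") auto
  qed
  have high: "vertex_degree E k = card {1..r} \<or> vertex_degree E k = d k" if k: "k \<in> {r<..n}" for k
  proof (rule ccontr)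
    assume not: "\<not> ?thesis"
    note sub = nbr_low[OF k]
    have "neighbours E k \<noteq> {1..r}"
      using not by (auto simp: vertex_degree_eq_card_neighbours[OF G])
    moreover have less: "vertex_degree E k < d k"
      using not le[of k] k r by auto
    have kr: "{k, r} \<in> E" using c0[OF k less] .
    ultimately obtain i where i: "i \<in> {1..r}" "i \<notin> neighbours E k"
      using sub by blast
    then have "i \<noteq> r" using kr by (auto simp: neighbours_def insert_commute)
    with i have i: "i \<in> {1..<r}" "{i, k} \<notin> E"
      by (auto simp: neighbours_def)
    obtain u where u: "{u, i} \<in> E" "{u, r} \<notin> E" "u \<noteq> r"
      using obtain_private_neighbour[OF G bigger[OF i(1)]] .
    have "u \<noteq> k" using u kr by auto
    then have ne: "{i, k} \<noteq> {u, r}" "u \<noteq> i" "u \<in> {1..n}"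
      using i E[OF u(1)] k by (auto simp: doubleton_eq_iff)
    note degs = vertex_degree_singleton vertex_degree_doubleton[OF ne(1)]
    \<comment> \<open>Trade \<open>ui\<close> for \<open>ik\<close> and \<open>ur\<close>: the degrees of \<open>u\<close> and \<open>i\<close> do not change.\<close>
    show False
    proof (rule exch[of "{{u, i}}" "{{i, k}, {u, r}}"])
      show "{{i, k}, {u, r}} \<inter> E = {}" using u i by simp
      show "e \<subseteq> {1..n} \<and> card e = 2 \<and> (\<exists>a\<in>e. a \<le> r)" if "e \<in> {{i, k}, {u, r}}" for e
        using that u i k ne r by (auto simp: card_insert_if)
      show "vertex_degree {{i, k}, {u, r}} x = vertex_degree {{u, i}} x" if "x \<in> {1..<r}" for x
        using that u i k ne by (auto simp: degs)
      show "vertex_degree E x + vertex_degree {{i, k}, {u, r}} x \<le> d x + vertex_degree {{u, i}} x"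
        if "x \<in> {r..n}" for x
        using that le'[OF that] deficient less u i k ne \<open>u \<noteq> k\<close>
        by (cases "x = r"; cases "x = k") (auto simp: degs)
      show "vertex_degree {{u, i}} r < vertex_degree {{i, k}, {u, r}} r"
        using u i k by (simp add: degs)
    qed (use u in simp_all)
  qed
  have "card (neighbours E i \<inter> {1..r}) = r - 1" if i: "i \<in> {1..r}" for i
  proof -
    have "{j, i} \<in> E" if j: "j \<in> {1..r}" "j \<noteq> i" for j
      using i j c1[of i] c1[of j] low[of i j] low[of j i]
      by (cases "i = r"; cases "j = r"; cases "i < j") (auto simp: insert_commute)
    moreover have "{i, i} \<notin> E" using E by blast
    ultimately have "neighbours E i \<inter> {1..r} = {1..r} - {i}"
      by (auto simp: neighbours_def)
    with i show ?thesis by simp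
  qed
  then have "(\<Sum>i=1..r. card (neighbours E i \<inter> {1..r})) = r * (r - 1)"
    by simp
  moreover have "(\<Sum>k=r+1..n. card (neighbours E k \<inter> {1..r})) = (\<Sum>k=r+1..n. min (d k) r)"
  proof (rule sum.cong)
    fix k assume k: "k \<in> {r+1..n}"
    have sub: "neighbours E k \<subseteq> {1..r}"
      using nbr_low k by simp
    then have "neighbours E k \<inter> {1..r} = neighbours E k" by auto
    moreover have "vertex_degree E k \<le> r"
      using sub card_mono[of "{1..r}" "neighbours E k"]
      by (simp add: vertex_degree_eq_card_neighbours[OF G])
    ultimately show "card (neighbours E k \<inter> {1..r}) = min (d k) r"
      using high[of k] k le'[of k] by (auto simp: vertex_degree_eq_card_neighbours[OF G])
  qed simp
  moreover have "{1..n} - {1..r} = {r+1..n}" using r by auto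
  ultimately have "(\<Sum>i=1..r. vertex_degree E i) = r * (r - 1) + (\<Sum>k=r+1..n. min (d k) r)"
    using sum_vertex_degree_split[OF G, of "{1..r}"] r by auto
  moreover have "(\<Sum>i=1..r. vertex_degree E i) < (\<Sum>i=1..r. d i)"
    using r deficient le by (intro sum_strict_mono_ex1) auto
  ultimately show False using eg by simp
qed

lemma partial_realization_saturate:
  assumes mono: "antimono_on {1..n} d" and parity: "even (\<Sum>i=1..n. d i)"
    and eg: "(\<Sum>i=1..r. d i) \<le> r * (r - 1) + (\<Sum>i=r+1..n. min (d i) r)"
    and P: "partial_realization n d r E" and r: "r \<in> {1..n}"
  shows "\<exists>E'. partial_realization n d (Suc r) E'"
  using P
proof (induction "d r - vertex_degree E r" arbitrary: E rule: less_induct)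
  case less
  have le: "vertex_degree E r \<le> d r"
    using less.prems r by (auto simp: partial_realization_def)
  show ?case
  proof (cases "vertex_degree E r = d r")
    case True
    then have "partial_realization n d (Suc r) E"
      using less.prems by (auto simp: partial_realization_def less_Suc_eq)
    then show ?thesis by blast
  next
    case False
    then obtain E' where E': "partial_realization n d r E'" "vertex_degree E r < vertex_degree E' r"
      using partial_realization_improve[OF mono parity eg less.prems r] le by auto
    show ?thesis
      using False le E' by (intro less.hyps[OF _ E'(1)]) simp
  qed
qed

text \<open>
The Erdos-Gallai theorem (sufficiency), by completing the vertices in order of decreasing target
degree, starting from the graph without edges.
\<close>
theorem erdos_gallai_sufficient:
  assumes mono: "antimono_on {1..n} d" and parity: "even (\<Sum>i=1..n. d i)"
    and eg: "\<And>k. k \<in> {1..n} \<Longrightarrow>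
      (\<Sum>i=1..k. d i) \<le> k * (k - 1) + (\<Sum>i=k+1..n. min (d i) k)"
  shows "degree_sequence n d"
proof -
  have "\<exists>E. partial_realization n d (Suc r) E" if "r \<le> n" for r
    using that
  proof (induction r)
    case 0
    have "partial_realization n d (Suc 0) {}"
      by (auto simp: partial_realization_def simple_graph_def vertex_degree_empty)
    then show ?case by blast
  next
    case (Suc r)
    then show ?case
      using partial_realization_saturate[OF mono parity eg] by force
  qed
  then obtain E where "partial_realization n d (Suc n) E" by blast
  then show ?thesis
    using mono by (auto simp: degree_sequence_def partial_realization_def)
qed

section \<open>Integrals of nonincreasing functions\<close>

lemma antimono_integrable:
  fixes h :: "real \<Rightarrow> real"
  assumes "antimono_on {0..1} h" "0 \<le> a" "b \<le> 1"
  shows "h integrable_on {a..b}"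
proof -
  have "mono_on {a..b} (\<lambda>x. - h x)"
    using assms by (auto simp: monotone_on_def)
  then have "integrable (lebesgue_on {a..b}) (\<lambda>x. - h x)"
    by (rule integrable_mono_on)
  then have "(\<lambda>x. - h x) integrable_on {a..b}"
    by (intro integrable_on_lebesgue_on) auto
  then show ?thesis
    by (simp add: integrable_neg_iff)
qed

lemma antimono_min:
  fixes h :: "real \<Rightarrow> real"
  shows "antimono_on A h \<Longrightarrow> antimono_on A (\<lambda>y. min (h y) x)"
  by (auto simp: monotone_on_def min_le_iff_disj)

lemma abs_integral_le_integral:
  fixes g h :: "real \<Rightarrow> real"
  assumes "h integrable_on S" "g integrable_on S" "\<And>x. x \<in> S \<Longrightarrow> \<bar>h x\<bar> \<le> g x"
  shows "\<bar>integral S h\<bar> \<le> integral S g"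
  using Henstock_Kurzweil_Integration.integral_norm_bound_integral[of h S g] assms by simp

lemma abs_integral_le:
  fixes h :: "real \<Rightarrow> real"
  assumes "h integrable_on {a..b}" "\<And>x. x \<in> {a..b} \<Longrightarrow> \<bar>h x\<bar> \<le> B" "a \<le> b"
  shows "\<bar>integral {a..b} h\<bar> \<le> B * (b - a)"
proof -
  have "\<bar>integral {a..b} h\<bar> \<le> integral {a..b} (\<lambda>_. B)"
    using assms by (intro abs_integral_le_integral) auto
  with assms(3) show ?thesis by (simp add: mult.commute)
qed

text \<open>
On each cell of length \<open>1/n\<close> a nonincreasing function lies between its two end values, and the
resulting errors telescope.
\<close>
lemma antimono_riemann_sum:
  fixes h :: "real \<Rightarrow> real" and a b n :: nat
  assumes mono: "antimono_on {0..1} h" and ab: "a \<le> b" and bn: "b \<le> n" and n: "0 < n"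
  shows "\<bar>(\<Sum>i=a+1..b. h (i / n)) / n - integral {a/n..b/n} h\<bar> \<le> (h (a/n) - h (b/n)) / n"
proof -
  have "(\<Sum>i=a+1..b. h (i / n)) / n \<le> integral {a/n..b/n} h \<and>
      integral {a/n..b/n} h \<le> (\<Sum>i=a+1..b. h (i / n)) / n + (h (a/n) - h (b/n)) / n"
    using ab bn
  proof (induction b rule: dec_induct)
    case (step m)
    define l r where lr_def: "l = real m / real n" "r = real (Suc m) / real n"
    have lr: "l \<le> r" "r - l = 1 / n" "0 \<le> l" "r \<le> 1" "a/n \<le> l" "0 \<le> a/n"
      using n step by (auto simp: lr_def field_simps)
    have hint: "h integrable_on {a/n..r}" "h integrable_on {l..r}"
      using antimono_integrable[OF mono lr(6,4)] antimono_integrable[OF mono lr(3,4)] by auto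
    have split: "integral {a/n..r} h = integral {a/n..l} h + integral {l..r} h"
      by (rule Henstock_Kurzweil_Integration.integral_combine[symmetric]) (use lr hint in auto)
    have cell: "h r \<le> h t" "h t \<le> h l" if "t \<in> {l..r}" for t
      using that lr(1,3,4) by (auto intro!: monotone_onD[OF mono])
    have "integral {l..r} (\<lambda>_. h r) \<le> integral {l..r} h"
      using hint(2) cell by (intro integral_le) auto
    moreover have "integral {l..r} h \<le> integral {l..r} (\<lambda>_. h l)"
      using hint(2) cell by (intro integral_le) auto
    ultimately have "h r / n \<le> integral {l..r} h" "integral {l..r} h \<le> h l / n"
      using lr by auto
    moreover have "(\<Sum>i=a+1..Suc m. h (i / n)) = (\<Sum>i=a+1..m. h (i / n)) + h r"
      using step by (simp add: lr_def)
    moreover note step.IH[OF Suc_leD[OF step.prems]]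
    ultimately show ?case
      using split unfolding lr_def[symmetric]
      by (simp only: add_divide_distrib diff_divide_distrib) linarith
  qed simp
  then show ?thesis by simp
qed

section \<open>The continuous Erdos-Gallai gap\<close>

text \<open>
The limit of the Erdos-Gallai inequalities: \<open>k/n\<close> becomes \<open>x\<close> and all terms are divided by \<open>n\<^sup>2\<close>.
\<close>
definition eg_gap :: "(real \<Rightarrow> real) \<Rightarrow> real \<Rightarrow> real" where
  "eg_gap f x = integral {x..1} (\<lambda>y. min (f y) x) + x\<^sup>2 - integral {0..x} f"

text \<open>
The Erdos-Gallai slack with \<open>k\<^sup>2\<close> in place of \<open>k * (k - 1)\<close>; the difference \<open>k\<close> vanishes in the
limit after division by \<open>n\<^sup>2\<close>.
\<close>
definition eg_slack :: "nat \<Rightarrow> (nat \<Rightarrow> nat) \<Rightarrow> nat \<Rightarrow> real" where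
  "eg_slack n d k = real k ^ 2 + (\<Sum>i=k+1..n. min (real (d i)) k) - (\<Sum>i=1..k. real (d i))"

text \<open>
The bridge between graphs and functions. Replacing \<open>d i / n\<close> by \<open>f (i / n)\<close> costs the average
deviation, since \<open>min _ x\<close> is 1-Lipschitz, and replacing the two sums by integrals costs at most
\<open>(f 0 - f 1) / n\<close> each. The bound does not depend on \<open>k\<close>.
\<close>
lemma eg_slack_approx:
  fixes f :: "real \<Rightarrow> real" and k n :: nat
  assumes mono: "antimono_on {0..1} f" and k: "k \<le> n" and n: "0 < n"
  shows "\<bar>eg_slack n d k / n\<^sup>2 - eg_gap f (k/n)\<bar> \<le>
    (1/n) * (\<Sum>i=1..n. \<bar>d i / n - f (i / n)\<bar>) + 2 * (f 0 - f 1) / n"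
proof -
  define x where "x = real k / real n"
  have x: "0 \<le> x" "x \<le> 1" using k n by (auto simp: x_def)
  define e where "e = (\<lambda>i. \<bar>d i / n - f (i / n)\<bar>)"
  have anti: "f b \<le> f a" if "0 \<le> a" "a \<le> b" "b \<le> 1" for a b
    using that by (intro monotone_onD[OF mono]) auto
  have slack: "eg_slack n d k / n\<^sup>2 = (\<Sum>i=k+1..n. min (d i / n) x) / n + x\<^sup>2 - (\<Sum>i=1..k. d i / n) / n"
  proof -
    have "min (d i / n) x = min (real (d i)) k / n" for i
      using n by (simp add: x_def min_divide_distrib_right)
    then show ?thesis
      by (simp add: eg_slack_def x_def power2_eq_square add_divide_distrib diff_divide_distrib
          flip: sum_divide_distrib)
  qed
  have "\<bar>(\<Sum>i=k+1..n. min (d i / n) x) - (\<Sum>i=k+1..n. min (f (i / n)) x)\<bar> \<le> (\<Sum>i=k+1..n. e i)"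
    unfolding sum_subtractf[symmetric] e_def by (intro order_trans[OF sum_abs] sum_mono) auto
  then have 1: "\<bar>(\<Sum>i=k+1..n. min (d i / n) x) / n - (\<Sum>i=k+1..n. min (f (i / n)) x) / n\<bar> \<le> (\<Sum>i=k+1..n. e i) / n"
    using n by (simp add: divide_right_mono flip: diff_divide_distrib)
  have "\<bar>(\<Sum>i=1..k. d i / n) - (\<Sum>i=1..k. f (i / n))\<bar> \<le> (\<Sum>i=1..k. e i)"
    unfolding sum_subtractf[symmetric] e_def by (intro order_trans[OF sum_abs] sum_mono) auto
  then have 2: "\<bar>(\<Sum>i=1..k. d i / n) / n - (\<Sum>i=1..k. f (i / n)) / n\<bar> \<le> (\<Sum>i=1..k. e i) / n"
    using n by (simp add: divide_right_mono flip: diff_divide_distrib)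
  have "\<bar>(\<Sum>i=k+1..n. min (f (i / n)) x) / n - integral {x..1} (\<lambda>y. min (f y) x)\<bar>
      \<le> (min (f x) x - min (f 1) x) / n"
    using antimono_riemann_sum[OF antimono_min[OF mono] k order_refl n, of x] n
    by (simp add: x_def)
  also have "\<dots> \<le> (f 0 - f 1) / n"
    using anti[of 0 x] anti[of x 1] x by (intro divide_right_mono) auto
  finally have 3: "\<bar>(\<Sum>i=k+1..n. min (f (i / n)) x) / n - integral {x..1} (\<lambda>y. min (f y) x)\<bar> \<le> (f 0 - f 1) / n" .
  have "\<bar>(\<Sum>i=1..k. f (i / n)) / n - integral {0..x} f\<bar> \<le> (f 0 - f x) / n"
    using antimono_riemann_sum[OF mono _ k n, of 0] by (simp add: x_def)
  also have "\<dots> \<le> (f 0 - f 1) / n"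
    using anti[of x 1] x by (intro divide_right_mono) auto
  finally have 4: "\<bar>(\<Sum>i=1..k. f (i / n)) / n - integral {0..x} f\<bar> \<le> (f 0 - f 1) / n" .
  have "{1..n} = {1..k} \<union> {k+1..n}" using k by auto
  then have "(\<Sum>i=1..n. e i) = (\<Sum>i=1..k. e i) + (\<Sum>i=k+1..n. e i)"
    by (simp add: sum.union_disjoint)
  then have 5: "(1/n) * (\<Sum>i=1..n. e i) = (\<Sum>i=1..k. e i) / n + (\<Sum>i=k+1..n. e i) / n"
    by (simp add: add_divide_distrib)
  have "\<bar>eg_slack n d k / n\<^sup>2 - eg_gap f x\<bar> \<le> (1/n) * (\<Sum>i=1..n. e i) + 2 * (f 0 - f 1) / n"
    unfolding slack eg_gap_def 5 using 1 2 3 4 by linarith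
  then show ?thesis by (simp add: x_def e_def)
qed

lemma eg_gap_lipschitz:
  fixes f :: "real \<Rightarrow> real"
  assumes mono: "antimono_on {0..1} f" and bound: "\<And>x. x \<in> {0..1} \<Longrightarrow> \<bar>f x\<bar> \<le> M"
    and xy: "0 \<le> x" "x \<le> y" "y \<le> 1"
  shows "\<bar>eg_gap f x - eg_gap f y\<bar> \<le> (2 * M + 4) * (y - x)"
proof -
  note int = antimono_integrable[OF mono] antimono_integrable[OF antimono_min[OF mono]]
  have "integral {x..1} (\<lambda>t. min (f t) x) = integral {x..y} (\<lambda>t. min (f t) x) + integral {y..1} (\<lambda>t. min (f t) x)"
    by (rule Henstock_Kurzweil_Integration.integral_combine[symmetric]) (use xy int in auto)
  moreover have "integral {0..y} f = integral {0..x} f + integral {x..y} f"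
    by (rule Henstock_Kurzweil_Integration.integral_combine[symmetric]) (use xy int in auto)
  moreover have "integral {y..1} (\<lambda>t. min (f t) x) - integral {y..1} (\<lambda>t. min (f t) y)
      = integral {y..1} (\<lambda>t. min (f t) x - min (f t) y)"
    by (rule Henstock_Kurzweil_Integration.integral_diff[symmetric]) (use xy int in auto)
  moreover have "\<bar>integral {x..y} (\<lambda>t. min (f t) x)\<bar> \<le> (M + 1) * (y - x)"
  proof (rule abs_integral_le)
    fix t assume "t \<in> {x..y}"
    then show "\<bar>min (f t) x\<bar> \<le> M + 1" using bound[of t] xy by auto
  qed (use xy int in auto)
  moreover have "\<bar>integral {x..y} f\<bar> \<le> M * (y - x)"
    by (rule abs_integral_le) (use xy int bound in auto)
  moreover have "\<bar>integral {y..1} (\<lambda>t. min (f t) x - min (f t) y)\<bar> \<le> (y - x) * (1 - y)"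
    by (rule abs_integral_le)
       (use xy int in \<open>auto intro!: Henstock_Kurzweil_Integration.integrable_diff\<close>)
  moreover have "(y - x) * (1 - y) \<le> (y - x) * 1"
    using xy by (intro mult_left_mono) auto
  moreover have "\<bar>x\<^sup>2 - y\<^sup>2\<bar> \<le> 2 * (y - x)"
  proof -
    have "x\<^sup>2 - y\<^sup>2 = - ((x + y) * (y - x))" by (simp add: power2_eq_square algebra_simps)
    then have "\<bar>x\<^sup>2 - y\<^sup>2\<bar> = (x + y) * (y - x)" using xy by (simp add: abs_mult)
    also have "\<dots> \<le> 2 * (y - x)" using xy by (intro mult_right_mono) auto
    finally show ?thesis .
  qed
  ultimately show ?thesis
    unfolding eg_gap_def by (simp add: algebra_simps) 
qed

lemma continuous_on_eg_gap:
  fixes f :: "real \<Rightarrow> real"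
  assumes mono: "antimono_on {0..1} f"
  shows "continuous_on {0..1} (eg_gap f)"
proof -
  define M where "M = max \<bar>f 0\<bar> \<bar>f 1\<bar>"
  have bound: "\<bar>f x\<bar> \<le> M" if "x \<in> {0..1}" for x
    using monotone_onD[OF mono, of 0 x] monotone_onD[OF mono, of x 1] that by (auto simp: M_def)
  have "(2 * M + 4)-lipschitz_on {0..1} (eg_gap f)"
  proof (rule lipschitz_onI)
    fix x y :: real assume "x \<in> {0..1}" "y \<in> {0..1}"
    then show "dist (eg_gap f x) (eg_gap f y) \<le> (2 * M + 4) * dist x y"
      using eg_gap_lipschitz[OF mono bound, of x y] eg_gap_lipschitz[OF mono bound, of y x]
      by (cases "x \<le> y") (auto simp: dist_real_def)
  qed (simp add: M_def)
  then show ?thesis by (rule lipschitz_on_continuous_on)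
qed

lemma dist1'_ge:
  assumes "f \<in> D_space" "g \<in> D_space"
  shows "\<bar>f 0 - g 0\<bar> \<le> dist1' f g" "\<bar>f 1 - g 1\<bar> \<le> dist1' f g"
    "integral {0..1} (\<lambda>x. \<bar>f x - g x\<bar>) \<le> dist1' f g"
  using Henstock_Kurzweil_Integration.integral_nonneg[OF D_space_abs_diff_integrable[OF assms]]
  by (auto simp: dist1'_def norm1'_def)

text \<open>
The gap is Lipschitz in \<open>f\<close>, uniformly in \<open>x\<close>, which makes strict positivity on a compact set of
\<open>x\<close> an open condition.
\<close>
lemma eg_gap_dist:
  assumes f: "f \<in> D_space" and g: "g \<in> D_space" and x: "0 \<le> x" "x \<le> 1"
  shows "\<bar>eg_gap f x - eg_gap g x\<bar> \<le> dist1' f g"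
proof -
  have mono: "antimono_on {0..1} f" "antimono_on {0..1} g"
    using f g by (auto simp: D_space_def)
  have int: "f integrable_on {0..x}" "g integrable_on {0..x}"
    "(\<lambda>t. min (f t) x) integrable_on {x..1}" "(\<lambda>t. min (g t) x) integrable_on {x..1}"
    using mono x by (simp_all add: antimono_integrable antimono_min)
  note absint = D_space_abs_diff_integrable[OF f g]
  have absint': "(\<lambda>t. \<bar>f t - g t\<bar>) integrable_on {0..x}" "(\<lambda>t. \<bar>f t - g t\<bar>) integrable_on {x..1}"
    using x by (intro integrable_on_subinterval[OF absint]; simp)+
  have "integral {x..1} (\<lambda>t. min (f t) x) - integral {x..1} (\<lambda>t. min (g t) x)
      = integral {x..1} (\<lambda>t. min (f t) x - min (g t) x)"
    using int(3,4) by (rule Henstock_Kurzweil_Integration.integral_diff[symmetric])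
  moreover have "\<bar>integral {x..1} (\<lambda>t. min (f t) x - min (g t) x)\<bar> \<le> integral {x..1} (\<lambda>t. \<bar>f t - g t\<bar>)"
    using Henstock_Kurzweil_Integration.integrable_diff[OF int(3,4)] absint'(2)
    by (rule abs_integral_le_integral) linarith
  moreover have "integral {0..x} f - integral {0..x} g = integral {0..x} (\<lambda>t. f t - g t)"
    using int(1,2) by (rule Henstock_Kurzweil_Integration.integral_diff[symmetric])
  moreover have "\<bar>integral {0..x} (\<lambda>t. f t - g t)\<bar> \<le> integral {0..x} (\<lambda>t. \<bar>f t - g t\<bar>)"
    using Henstock_Kurzweil_Integration.integrable_diff[OF int(1,2)] absint'(1)
    by (rule abs_integral_le_integral) simp
  moreover have "integral {0..x} (\<lambda>t. \<bar>f t - g t\<bar>) + integral {x..1} (\<lambda>t. \<bar>f t - g t\<bar>)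
      = integral {0..1} (\<lambda>t. \<bar>f t - g t\<bar>)"
    using x absint by (rule Henstock_Kurzweil_Integration.integral_combine)
  ultimately show ?thesis
    using dist1'_ge(3)[OF f g] unfolding eg_gap_def by linarith
qed

section \<open>Scaling limits satisfy the limiting inequalities\<close>

lemma degree_sequence_less:
  assumes "degree_sequence n d" "i \<in> {1..n}"
  shows "d i < n"
proof -
  obtain E where G: "simple_graph {1..n} E" and "\<forall>i\<in>{1..n}. d i = vertex_degree E i"
    using assms(1) unfolding degree_sequence_def by blast
  with assms(2) have d: "d i = vertex_degree E i" by blast
  have "card (neighbours E i) \<le> card ({1..n} - {i})"
    by (rule card_mono[OF _ neighbours_subset[OF G]]) simp
  also have "\<dots> < card {1..n}"
    using assms(2) by (rule card_Diff1_less[OF finite_atLeastAtMost])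
  finally show ?thesis
    by (simp add: d vertex_degree_eq_card_neighbours[OF G])
qed

lemma abs_div_diff_le:
  fixes a s :: real
  assumes "0 < n" "\<bar>a - real n * s\<bar> \<le> 1"
  shows "\<bar>a / n - s\<bar> \<le> 1 / n"
proof -
  have "a / n - s = (a - n * s) / n" using assms(1) by (simp add: diff_divide_distrib)
  then have "\<bar>a / n - s\<bar> = \<bar>a - n * s\<bar> / n" by simp
  also have "\<dots> \<le> 1 / n" using assms(2) by (intro divide_right_mono) simp_all
  finally show ?thesis .
qed

lemma degree_sequence_zero: "degree_sequence n (\<lambda>_. 0)"
proof -
  have "simple_graph {1..n} {} \<and> (\<forall>i\<in>{1..n}. 0 = vertex_degree {} i)"
    by (simp add: simple_graph_def vertex_degree_empty)
  then show ?thesis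
    unfolding degree_sequence_def by (intro conjI exI) (auto simp: monotone_on_def)
qed

lemma eg_slack_nonneg:
  assumes "degree_sequence n d" "k \<le> n"
  shows "0 \<le> eg_slack n d k"
proof -
  obtain E where G: "simple_graph {1..n} E" and d: "\<And>i. i \<in> {1..n} \<Longrightarrow> d i = vertex_degree E i"
    using assms by (auto simp: degree_sequence_def)
  have "(\<Sum>i=1..k. d i) = (\<Sum>i=1..k. vertex_degree E i)"
    using d assms(2) by (intro sum.cong) simp_all
  moreover have "(\<Sum>i=k+1..n. min (d i) k) = (\<Sum>i=k+1..n. min (vertex_degree E i) k)"
    using d by (intro sum.cong) simp_all
  moreover have "k * (k - 1) \<le> k * k" by (intro mult_left_mono) simp_all
  ultimately have "(\<Sum>i=1..k. d i) \<le> k * k + (\<Sum>i=k+1..n. min (d i) k)"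
    using erdos_gallai_necessary[OF G assms(2)] by linarith
  then have "real (\<Sum>i=1..k. d i) \<le> real (k * k + (\<Sum>i=k+1..n. min (d i) k))"
    by (rule of_nat_mono)
  then show ?thesis by (simp add: eg_slack_def of_nat_min power2_eq_square)
qed

text \<open>
The slack has to absorb the \<open>k\<close> by which \<open>k\<^sup>2\<close> exceeds \<open>k * (k - 1)\<close>.
\<close>
lemma degree_sequence_if_slack:
  assumes "antimono_on {1..n} d" "even (\<Sum>i=1..n. d i)"
    and slack: "\<And>k. k \<in> {1..n} \<Longrightarrow> real k \<le> eg_slack n d k"
  shows "degree_sequence n d"
proof (rule erdos_gallai_sufficient[OF assms(1,2)])
  fix k assume k: "k \<in> {1..n}"
  define S where "S = (\<Sum>i=k+1..n. min (d i) k)"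
  have "real S = (\<Sum>i=k+1..n. min (real (d i)) k)"
    by (simp add: S_def of_nat_min)
  with slack[OF k] have "real (\<Sum>i=1..k. d i) \<le> real k ^ 2 - real k + real S"
    by (simp add: eg_slack_def)
  also have "real k ^ 2 - real k = real (k * (k - 1))"
    using k by (simp add: of_nat_diff power2_eq_square right_diff_distrib)
  finally have "real (\<Sum>i=1..k. d i) \<le> real (k * (k - 1) + S)"
    by (simp only: of_nat_add)
  then show "(\<Sum>i=1..k. d i) \<le> k * (k - 1) + (\<Sum>i=k+1..n. min (d i) k)"
    unfolding S_def by (simp only: of_nat_le_iff)
qed

definition scaling_error :: "nat \<Rightarrow> (nat \<Rightarrow> nat) \<Rightarrow> (real \<Rightarrow> real) \<Rightarrow> real" where
  "scaling_error n d f = (1 / n) * (\<Sum>i=1..n. \<bar>d i / n - f (i / n)\<bar>)"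

lemma scaling_error_nonneg: "0 \<le> scaling_error n d f"
  by (simp add: scaling_error_def sum_nonneg)

lemma has_scaling_limitD:
  assumes "has_scaling_limit d f"
  shows "(\<lambda>n. real (d n 1) / n) \<longlonglongrightarrow> f 0" "(\<lambda>n. real (d n n) / n) \<longlonglongrightarrow> f 1"
    "(\<lambda>n. scaling_error n (d n) f) \<longlonglongrightarrow> 0"
proof -
  define a b e where "a n = \<bar>real (d n 1) / n - f 0\<bar>" and "b n = \<bar>real (d n n) / n - f 1\<bar>"
    and "e n = scaling_error n (d n) f" for n
  have nonneg: "0 \<le> a n" "0 \<le> b n" "0 \<le> e n" for n
    by (simp_all add: a_def b_def e_def scaling_error_nonneg)
  have lim: "(\<lambda>n. a n + b n + e n) \<longlonglongrightarrow> 0"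
    using assms unfolding has_scaling_limit_def scaling_error_def a_def b_def e_def .
  have "norm (a n) \<le> a n + b n + e n" "norm (b n) \<le> a n + b n + e n" "norm (e n) \<le> a n + b n + e n" for n
    using nonneg[of n] by simp_all
  then have "a \<longlonglongrightarrow> 0" "b \<longlonglongrightarrow> 0" "e \<longlonglongrightarrow> 0"
    by (auto intro: Lim_null_comparison[OF always_eventually lim])
  then have "(\<lambda>n. \<bar>real (d n 1) / n - f 0\<bar>) \<longlonglongrightarrow> 0" "(\<lambda>n. \<bar>real (d n n) / n - f 1\<bar>) \<longlonglongrightarrow> 0"
    "(\<lambda>n. scaling_error n (d n) f) \<longlonglongrightarrow> 0"
    unfolding a_def b_def e_def .
  then show "(\<lambda>n. real (d n 1) / n) \<longlonglongrightarrow> f 0" "(\<lambda>n. real (d n n) / n) \<longlonglongrightarrow> f 1"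
    "(\<lambda>n. scaling_error n (d n) f) \<longlonglongrightarrow> 0"
    by (simp_all only: tendsto_rabs_zero_iff LIM_zero_iff)
qed

lemma scaling_limits_bounds:
  assumes "f \<in> scaling_limits"
  shows "f 0 \<le> 1" "0 \<le> f 1"
proof -
  obtain d where d: "\<And>n. degree_sequence n (d n)" "has_scaling_limit d f"
    using assms by (auto simp: scaling_limits_def)
  show "f 0 \<le> 1"
  proof (rule LIMSEQ_le_const2[OF has_scaling_limitD(1)[OF d(2)]], intro exI allI impI)
    fix n :: nat assume "1 \<le> n"
    then show "real (d n 1) / n \<le> 1"
      using degree_sequence_less[OF d(1), of 1 n] by simp
  qed
  show "0 \<le> f 1"
    by (rule LIMSEQ_le_const[OF has_scaling_limitD(2)[OF d(2)]]) simp
qed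

text \<open>
Divide the Erdos-Gallai inequalities for \<open>k = \<lfloor>n x\<rfloor>\<close> by \<open>n\<^sup>2\<close> and let \<open>n\<close> tend to infinity; by
continuity of the gap its values at \<open>k/n\<close> tend to the one at \<open>x\<close>.
\<close>
lemma eg_gap_nonneg:
  assumes "f \<in> scaling_limits" and x: "x \<in> {0..1}"
  shows "0 \<le> eg_gap f x"
proof -
  obtain d where d: "\<And>n. degree_sequence n (d n)" "has_scaling_limit d f" and f: "f \<in> D_space"
    using assms by (auto simp: scaling_limits_def)
  then have mono: "antimono_on {0..1} f" by (simp add: D_space_def)
  define k where "k = (\<lambda>n. nat \<lfloor>real n * x\<rfloor>)"
  have k: "real (k n) \<le> n * x" "n * x < real (k n) + 1" for n
    using x by (auto simp: k_def of_nat_nat)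
  have kn: "k n \<le> n" for n
  proof -
    have "real n * x \<le> real n * 1" using x by (intro mult_left_mono) auto
    with k(1)[of n] show ?thesis by simp
  qed
  have "(\<lambda>n. real (k n) / n) \<longlonglongrightarrow> x"
  proof (rule LIM_zero_cancel, rule Lim_null_comparison)
    show "\<forall>\<^sub>F n in sequentially. norm (real (k n) / n - x) \<le> 1 / real n"
      using eventually_gt_at_top[of 0]
    proof eventually_elim
      case (elim n)
      have "\<bar>real (k n) - n * x\<bar> \<le> 1" using k[of n] by linarith
      with elim show ?case by (simp add: abs_div_diff_le)
    qed
  qed (rule lim_1_over_n)
  moreover have "real (k n) / n \<in> {0..1}" for n
    using kn[of n] by (cases "n = 0") (simp_all add: divide_le_eq_1)
  ultimately have lim: "(\<lambda>n. eg_gap f (real (k n) / n)) \<longlonglongrightarrow> eg_gap f x"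
    by (intro continuous_on_tendsto_compose[OF continuous_on_eg_gap[OF mono] _ x] always_eventually allI)
  have null: "(\<lambda>n. - scaling_error n (d n) f - 2 * (f 0 - f 1) / n) \<longlonglongrightarrow> 0"
    using tendsto_diff[OF tendsto_minus[OF has_scaling_limitD(3)[OF d(2)]] lim_const_over_n[of "2 * (f 0 - f 1)"]]
    by simp
  have bound: "\<forall>\<^sub>F n in sequentially.
      - scaling_error n (d n) f - 2 * (f 0 - f 1) / n \<le> eg_gap f (real (k n) / n)"
    using eventually_gt_at_top[of 0]
  proof eventually_elim
    case (elim n)
    have "0 \<le> eg_slack n (d n) (k n) / n\<^sup>2"
      using eg_slack_nonneg[OF d(1) kn] by simp
    with eg_slack_approx[OF mono kn elim, of "d n"] show ?case
      by (simp add: scaling_error_def)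
  qed
  show ?thesis
    by (rule tendsto_le[OF sequentially_bot lim null bound])
qed

section \<open>Realizing functions with positive gap\<close>

text \<open>
Rounding down preserves monotonicity. If the sum of the rounded values is odd, the first one is
raised by 1, which is the position where raising cannot destroy monotonicity.
\<close>
lemma even_rounding:
  fixes \<phi> :: "nat \<Rightarrow> real"
  assumes mono: "antimono_on {1..n} \<phi>" and nonneg: "\<And>i. i \<in> {1..n} \<Longrightarrow> 0 \<le> \<phi> i" and n: "1 \<le> n"
  shows "\<exists>d. antimono_on {1..n} d \<and> even (\<Sum>i=1..n. d i) \<and> (\<forall>i\<in>{1..n}. \<bar>real (d i) - \<phi> i\<bar> \<le> 1)"
proof -
  define a where "a = (\<lambda>i. nat \<lfloor>\<phi> i\<rfloor>)"
  define p where "p = (\<Sum>i=1..n. a i) mod 2"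
  define d where "d = (\<lambda>i. a i + (if i = 1 then p else 0))"
  have p: "p \<le> 1" by (simp add: p_def)
  have a: "real (a i) \<le> \<phi> i" "\<phi> i < real (a i) + 1" if "i \<in> {1..n}" for i
    using nonneg[OF that] by (auto simp: a_def of_nat_nat)
  have "antimono_on {1..n} d"
  proof (rule monotone_onI)
    fix i j assume ij: "i \<in> {1..n}" "j \<in> {1..n}" "i \<le> j"
    then have "a j \<le> a i"
      using monotone_onD[OF mono ij] by (auto simp: a_def intro!: nat_mono floor_mono)
    with ij show "d j \<le> d i" by (auto simp: d_def)
  qed
  moreover have "(\<Sum>i=1..n. d i) = (\<Sum>i=1..n. a i) + p"
    using n by (simp add: d_def sum.distrib)
  then have "even (\<Sum>i=1..n. d i)"
    unfolding p_def by presburger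
  moreover have "\<bar>real (d i) - \<phi> i\<bar> \<le> 1" if "i \<in> {1..n}" for i
    using a[OF that] p by (auto simp: d_def)
  ultimately show ?thesis by blast
qed

text \<open>
A scaling limit requires \<open>d 1 / n\<close> to approach \<open>f 0\<close>, but \<open>f (1 / n)\<close> need not do so, because
\<open>f\<close> may jump at 0. One wrong value out of \<open>n\<close> does not matter for the average deviation.
\<close>
definition sample :: "(real \<Rightarrow> real) \<Rightarrow> nat \<Rightarrow> nat \<Rightarrow> real" where
  "sample f n i = (if i = 1 then f 0 else f (i / n))"

lemma antimono_sample:
  assumes mono: "antimono_on {0..1} f"
  shows "antimono_on {1..n} (\<lambda>i. real n * sample f n i)"
proof (rule monotone_onI)
  fix i j assume ij: "i \<in> {1..n}" "j \<in> {1..n}" "i \<le> j"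
  have "sample f n j \<le> sample f n i"
    unfolding sample_def using ij
    by (auto intro!: monotone_onD[OF mono] divide_right_mono)
  then show "real n * sample f n j \<le> real n * sample f n i"
    by (intro mult_left_mono) auto
qed

lemma scaling_error_sample:
  assumes mono: "antimono_on {0..1} f" and range: "0 \<le> f 1" "f 0 \<le> 1" and n: "1 \<le> n"
    and d: "\<And>i. i \<in> {1..n} \<Longrightarrow> \<bar>real (d i) - real n * sample f n i\<bar> \<le> 1"
  shows "scaling_error n d f \<le> 2 / n"
proof -
  have "\<bar>d i / n - f (i / n)\<bar> \<le> 1 / n + of_bool (i = 1)" if i: "i \<in> {1..n}" for i
  proof -
    have 1: "\<bar>d i / n - sample f n i\<bar> \<le> 1 / n"
      using abs_div_diff_le[OF _ d[OF i]] n by simp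
    have "f (i / n) \<le> f 0" "f 1 \<le> f (i / n)"
      using i n by (auto intro!: monotone_onD[OF mono])
    then have "\<bar>sample f n i - f (i / n)\<bar> \<le> of_bool (i = 1)"
      using range by (auto simp: sample_def)
    with 1 show ?thesis by linarith
  qed
  then have "(\<Sum>i=1..n. \<bar>d i / n - f (i / n)\<bar>) \<le> (\<Sum>i=1..n. 1 / n + of_bool (i = 1))"
    by (intro sum_mono) auto
  also have "\<dots> = 2" using n by (simp add: sum.distrib)
  finally show ?thesis
    unfolding scaling_error_def using n by (simp add: field_simps)
qed

text \<open>
For small \<open>k\<close> the gap near 0 is too small to absorb rounding errors, so the slack is computed
directly: if \<open>k \<le> c1 * n - 1\<close>, then all degrees are at least \<open>k\<close> and the slack is \<open>k * n\<close> minus the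
sum of the first \<open>k\<close> degrees, each of which is at most \<open>c2 * n + 1\<close>. For larger \<open>k\<close> one has
\<open>k / n \<ge> c1 / 2\<close>, where the gap is at least \<open>m\<close> and all errors together are at most \<open>4 / n\<close>.
\<close>
lemma eg_slack_sample:
  assumes mono: "antimono_on {0..1} f"
    and range: "\<And>x. x \<in> {0..1} \<Longrightarrow> c1 \<le> f x \<and> f x \<le> c2" and c: "0 < c1" "c2 < 1"
    and gap: "\<And>x. x \<in> {c1/2..1} \<Longrightarrow> m \<le> eg_gap f x" and m: "0 < m"
    and d: "\<And>i. i \<in> {1..n} \<Longrightarrow> \<bar>real (d i) - real n * sample f n i\<bar> \<le> 1"
    and n: "1 \<le> n" "2 \<le> c1 * n" "2 \<le> (1 - c2) * n" "5 \<le> m * n" and k: "k \<in> {1..n}"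
  shows "real k \<le> eg_slack n d k"
proof (cases "real k \<le> c1 * n - 1")
  case True
  have sample: "c1 \<le> sample f n i \<and> sample f n i \<le> c2" if "i \<in> {1..n}" for i
    using range[of 0] range[of "i / n"] that by (auto simp: sample_def)
  have dge: "c1 * n - 1 \<le> real (d i)" and dle: "real (d i) \<le> c2 * n + 1" if i: "i \<in> {1..n}" for i
  proof -
    have "c1 * n \<le> n * sample f n i" "n * sample f n i \<le> c2 * n"
      using sample[OF i] n by (auto simp: mult.commute intro!: mult_left_mono)
    with d[OF i] show "c1 * n - 1 \<le> real (d i)" "real (d i) \<le> c2 * n + 1" by linarith+
  qed
  have "(\<Sum>i=k+1..n. min (real (d i)) k) = (\<Sum>i=k+1..n. real k)"
  proof (rule sum.cong)
    fix i assume "i \<in> {k+1..n}"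
    then show "min (real (d i)) k = k" using dge[of i] True by simp
  qed simp
  also have "\<dots> = (real n - k) * k" using k by (simp add: of_nat_diff)
  finally have 1: "(\<Sum>i=k+1..n. min (real (d i)) k) = (real n - k) * k" .
  have "(\<Sum>i=1..k. real (d i)) \<le> (\<Sum>i=1..k. c2 * n + 1)"
    using dle k by (intro sum_mono) auto
  also have "\<dots> = k * (c2 * n + 1)" by simp
  finally have 2: "(\<Sum>i=1..k. real (d i)) \<le> k * (c2 * n + 1)" .
  have "real k * 2 \<le> real k * ((1 - c2) * n)"
    using n by (intro mult_left_mono) auto
  then show ?thesis
    unfolding eg_slack_def 1 using 2 by (simp add: algebra_simps power2_eq_square)
next
  case False
  have npos: "0 < real n" using n by simp
  have "c1 / 2 * n \<le> k" using False n by simp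
  then have "k / n \<in> {c1/2..1}"
    using k npos by (auto simp: le_divide_eq)
  then have "m \<le> eg_gap f (k / n)" by (rule gap)
  moreover have f01: "0 \<le> f 1" "f 0 \<le> 1" "f 0 - f 1 \<le> 1"
    using range[of 0] range[of 1] c by auto
  moreover have "\<bar>eg_slack n d k / n\<^sup>2 - eg_gap f (k/n)\<bar> \<le> scaling_error n d f + 2 * (f 0 - f 1) / n"
    using eg_slack_approx[OF mono, of k n d] k by (simp add: scaling_error_def)
  moreover have "scaling_error n d f \<le> 2 / n"
    using scaling_error_sample[OF mono f01(1,2) n(1) d] .
  moreover have "2 * (f 0 - f 1) / n \<le> 2 / n"
    using f01 npos by (intro divide_right_mono) auto
  ultimately have "m - 4 / n \<le> eg_slack n d k / n\<^sup>2" by linarith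
  moreover have "1 / n \<le> m - 4 / n"
    using n(4) npos by (simp add: field_simps)
  ultimately have "1 / n \<le> eg_slack n d k / n\<^sup>2" by linarith
  then have "n \<le> eg_slack n d k"
    using npos by (simp add: field_simps power2_eq_square)
  with k show ?thesis by simp
qed

text \<open>
For \<open>x \<le> c1\<close> the minimum \<open>min (f y) x\<close> is \<open>x\<close>, and \<open>f \<le> c2\<close> bounds the subtracted integral. When
\<open>c2 < 1\<close>, this leaves only a compact range of \<open>x\<close>, away from 0, on which positivity is an issue.
\<close>
lemma eg_gap_near_0:
  assumes mono: "antimono_on {0..1} f"
    and range: "\<And>y. y \<in> {0..1} \<Longrightarrow> c1 \<le> f y \<and> f y \<le> c2" and x: "0 \<le> x" "x \<le> c1" "x \<le> 1"
  shows "(1 - c2) * x \<le> eg_gap f x"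
proof -
  have "integral {x..1} (\<lambda>y. min (f y) x) = integral {x..1} (\<lambda>_. x)"
  proof (rule integral_cong)
    fix y assume "y \<in> {x..1}"
    then show "min (f y) x = x" using range[of y] x by simp
  qed
  moreover have "integral {0..x} f \<le> integral {0..x} (\<lambda>_. c2)"
    using range x by (intro integral_le antimono_integrable[OF mono]) auto
  ultimately show ?thesis
    using x by (simp add: eg_gap_def algebra_simps power2_eq_square)
qed

lemma eg_gap_bounded_below:
  assumes mono: "antimono_on {0..1} f" and pos: "\<And>x. x \<in> {0<..1} \<Longrightarrow> 0 < eg_gap f x" and c: "0 < c"
  shows "\<exists>m>0. \<forall>x\<in>{c..1}. m \<le> eg_gap f x"
proof (cases "c \<le> 1")
  case True
  have "continuous_on {c..1} (eg_gap f)"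
    using continuous_on_eg_gap[OF mono] by (rule continuous_on_subset) (use c in auto)
  then obtain z where "z \<in> {c..1}" "\<forall>x\<in>{c..1}. eg_gap f z \<le> eg_gap f x"
    using continuous_attains_inf[of "{c..1}" "eg_gap f"] True by auto
  with pos[of z] c show ?thesis by auto
qed (auto intro: exI[of _ 1])

text \<open>
Round \<open>n * f (i / n)\<close> to degrees with even sum. For large \<open>n\<close> they satisfy the Erdos-Gallai
inequalities; for the finitely many remaining \<open>n\<close> any degree sequence, such as that of the graph
without edges, will do.
\<close>
lemma scaling_limits_if_gap_pos:
  assumes f: "f \<in> D_space"
    and range: "\<And>x. x \<in> {0..1} \<Longrightarrow> c1 \<le> f x \<and> f x \<le> c2" and c: "0 < c1" "c2 < 1"
    and pos: "\<And>x. x \<in> {0<..1} \<Longrightarrow> 0 < eg_gap f x"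
  shows "f \<in> scaling_limits"
proof -
  have mono: "antimono_on {0..1} f" using f by (simp add: D_space_def)
  obtain m where m: "0 < m" "\<And>x. x \<in> {c1/2..1} \<Longrightarrow> m \<le> eg_gap f x"
    using eg_gap_bounded_below[OF mono pos, of "c1/2"] c by auto
  define P where "P n d \<longleftrightarrow> degree_sequence n d \<and>
    (\<forall>i\<in>{1..n}. \<bar>real (d i) - real n * sample f n i\<bar> \<le> 1)" for n d
  have big: "\<forall>\<^sub>F n in sequentially. b \<le> a * real n" if "0 < a" for a b
  proof -
    have "filterlim (\<lambda>n. a * real n) at_top sequentially"
      using that by (intro filterlim_tendsto_pos_mult_at_top[OF tendsto_const] filterlim_real_sequentially)
    then show ?thesis by (simp add: filterlim_at_top)
  qed
  have ex: "\<forall>\<^sub>F n in sequentially. \<exists>d. P n d"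
    using eventually_ge_at_top[of 1] big[OF c(1), of 2] big[of "1 - c2" 2, simplified, OF c(2)] big[OF m(1), of 5]
  proof eventually_elim
    case (elim n)
    have "0 \<le> real n * sample f n i" if "i \<in> {1..n}" for i
      using range[of 0] range[of "i / n"] that c by (force simp: sample_def)
    then obtain d where d: "antimono_on {1..n} d" "even (\<Sum>i=1..n. d i)"
      "\<And>i. i \<in> {1..n} \<Longrightarrow> \<bar>real (d i) - real n * sample f n i\<bar> \<le> 1"
      using even_rounding[OF antimono_sample[OF mono] _ elim(1)] by blast
    have "degree_sequence n d"
      using d(1,2) eg_slack_sample[OF mono range c m(2,1) d(3) elim]
      by (intro degree_sequence_if_slack) auto
    with d(3) show ?case by (auto simp: P_def)
  qed
  \<comment> \<open>edgeless graphs for the finitely many \<open>n\<close> for which no rounding works\<close>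
  define D where "D n = (if \<exists>d. P n d then SOME d. P n d else (\<lambda>_. 0))" for n
  have PD: "P n (D n)" if "\<exists>d. P n d" for n
    using someI_ex[OF that] that by (simp add: D_def)
  have deg: "degree_sequence n (D n)" for n
    using PD[of n] by (cases "\<exists>d. P n d") (auto simp: P_def D_def degree_sequence_zero)
  have "has_scaling_limit D f"
    unfolding has_scaling_limit_def
  proof (rule Lim_null_comparison)
    show "(\<lambda>n. 4 / real n) \<longlonglongrightarrow> 0" by (rule lim_const_over_n)
    show "\<forall>\<^sub>F n in sequentially. norm (\<bar>real (D n 1) / real n - f 0\<bar> + \<bar>real (D n n) / real n - f 1\<bar>
        + (1 / real n) * (\<Sum>i=1..n. \<bar>real (D n i) / real n - f (real i / real n)\<bar>)) \<le> 4 / real n"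
      using ex eventually_ge_at_top[of 2]
    proof eventually_elim
      case (elim n)
      have near: "\<bar>real (D n i) - real n * sample f n i\<bar> \<le> 1" if "i \<in> {1..n}" for i
        using PD[OF elim(1)] that by (auto simp: P_def)
      have near': "\<bar>real (D n i) / n - sample f n i\<bar> \<le> 1 / n" if "i \<in> {1..n}" for i
        using abs_div_diff_le[OF _ near[OF that]] elim(2) by simp
      have "\<bar>real (D n 1) / n - f 0\<bar> \<le> 1 / n" "\<bar>real (D n n) / n - f 1\<bar> \<le> 1 / n"
        using near'[of 1] near'[of n] elim(2) by (auto simp: sample_def)
      moreover have "scaling_error n (D n) f \<le> 2 / n"
        using range[of 0] range[of 1] c elim(2) near by (intro scaling_error_sample[OF mono]) auto
      moreover note scaling_error_nonneg[of n "D n" f]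
      ultimately show ?case unfolding scaling_error_def by simp
    qed
  qed
  with f deg show ?thesis by (auto simp: scaling_limits_def)
qed

section \<open>The interior of the set of scaling limits\<close>

lemma in_interior_iff:
  "f \<in> D_topology interior_of S \<longleftrightarrow>
    f \<in> D_space \<and> (\<exists>r>0. \<forall>g\<in>D_space. dist1' f g < r \<longrightarrow> g \<in> S)"
proof -
  interpret Metric_space D_space dist1' by (rule Metric_space_D_space)
  have "f \<in> D_topology interior_of S \<longleftrightarrow> f \<in> D_space \<and> (\<exists>r>0. mball f r \<subseteq> S)"
    unfolding D_topology_def in_interior_of_mball by auto
  then show ?thesis by (force simp: subset_iff)
qed

text \<open>
The perturbations that leave the set of scaling limits when a condition fails: a shift on all
of \<open>[0,1]\<close> by \<open>c\<close> of either sign (\<open>x = 1\<close>), and a shift upwards on the initial part \<open>[0,x]\<close>.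
Including the point \<open>x\<close> keeps left continuity.
\<close>
definition raise :: "real \<Rightarrow> real \<Rightarrow> (real \<Rightarrow> real) \<Rightarrow> real \<Rightarrow> real" where
  "raise c x f = (\<lambda>y\<in>{0..1}. if y \<le> x then f y + c else f y)"

lemma raise_in_D_space:
  assumes f: "f \<in> D_space" and x: "0 \<le> c \<or> x = 1"
  shows "raise c x f \<in> D_space"
proof -
  have mono: "antimono_on {0..1} f" and cont: "\<And>y. y \<in> {0<..<1} \<Longrightarrow> continuous (at_left y) f"
    using f by (auto simp: D_space_def)
  have "antimono_on {0..1} (raise c x f)"
  proof (rule monotone_onI)
    fix y z :: real assume yz: "y \<in> {0..1}" "z \<in> {0..1}" "y \<le> z"
    then show "raise c x f z \<le> raise c x f y"
      using monotone_onD[OF mono yz] x by (auto simp: raise_def)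
  qed
  moreover have "continuous (at_left y) (raise c x f)" if y: "y \<in> {0<..<1}" for y
  proof -
    have "(f \<longlongrightarrow> f y) (at_left y)" using cont[OF y] by (simp add: continuous_within)
    moreover have "\<forall>\<^sub>F z in at_left y. z \<in> {0<..<y}"
      using y by (intro eventually_at_leftI[of 0]) auto
    ultimately have "(raise c x f \<longlongrightarrow> raise c x f y) (at_left y)"
    proof (cases "y \<le> x")
      case True
      have "((\<lambda>z. f z + c) \<longlongrightarrow> f y + c) (at_left y)"
        using \<open>(f \<longlongrightarrow> f y) (at_left y)\<close> by (intro tendsto_intros)
      moreover have "\<forall>\<^sub>F z in at_left y. f z + c = raise c x f z"
        using \<open>\<forall>\<^sub>F z in at_left y. z \<in> {0<..<y}\<close>
        by eventually_elim (use True y in \<open>auto simp: raise_def\<close>)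
      ultimately show ?thesis
        using True y by (auto simp: raise_def[of c x f] intro: Lim_transform_eventually)
    next
      case False
      have "\<forall>\<^sub>F z in at_left y. z \<in> {x<..<y}"
        using False by (intro eventually_at_leftI[of x]) auto
      with \<open>\<forall>\<^sub>F z in at_left y. z \<in> {0<..<y}\<close>
      have "\<forall>\<^sub>F z in at_left y. f z = raise c x f z"
        by eventually_elim (use y in \<open>auto simp: raise_def\<close>)
      with \<open>(f \<longlongrightarrow> f y) (at_left y)\<close> show ?thesis
        using False y by (auto simp: raise_def[of c x f] intro: Lim_transform_eventually)
    qed
    then show ?thesis by (simp add: continuous_within)
  qed
  ultimately show ?thesis by (auto simp: D_space_def raise_def)
qed

lemma dist1'_raise:
  assumes f: "f \<in> D_space" and x: "0 \<le> c \<or> x = 1"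
  shows "dist1' f (raise c x f) \<le> 3 * \<bar>c\<bar>"
proof -
  let ?g = "raise c x f"
  have near: "\<bar>f y - ?g y\<bar> \<le> \<bar>c\<bar>" if "y \<in> {0..1}" for y
    using that by (auto simp: raise_def)
  have "\<bar>integral {0..1} (\<lambda>y. \<bar>f y - ?g y\<bar>)\<bar> \<le> \<bar>c\<bar> * (1 - 0)"
    using near D_space_abs_diff_integrable[OF f raise_in_D_space[OF f x]]
    by (intro abs_integral_le) auto
  with near[of 0] near[of 1] show ?thesis
    by (simp add: dist1'_def norm1'_def)
qed

text \<open>
The values on \<open>[0,x]\<close> enter the gap at \<open>x\<close> only through the integral that is subtracted.
\<close>
lemma eg_gap_raise:
  assumes f: "f \<in> D_space" and x: "0 < x" "x \<le> 1"
  shows "eg_gap (raise c x f) x = eg_gap f x - c * x"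
proof -
  have mono: "antimono_on {0..1} f" using f by (simp add: D_space_def)
  have "integral {x..1} (\<lambda>y. min (raise c x f y) x) = integral {x..1} (\<lambda>y. min (f y) x)"
    by (rule integral_spike[of "{x}"]) (use x in \<open>auto simp: raise_def\<close>)
  moreover have "integral {0..x} (raise c x f) = integral {0..x} (\<lambda>y. f y + c)"
    using x by (intro integral_cong) (auto simp: raise_def)
  moreover have "\<dots> = integral {0..x} f + integral {0..x} (\<lambda>_. c)"
    using x by (intro Henstock_Kurzweil_Integration.integral_add antimono_integrable[OF mono]) auto
  ultimately show ?thesis
    using x by (simp add: eg_gap_def mult.commute)
qed

text \<open>
A scaling limit lies between 0 and 1 and has nonnegative gap. A small shift of \<open>f\<close> up, down, or up
on \<open>[0,x]\<close> is still a scaling limit and changes the respective quantity by a definite amount, so the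
inequalities for \<open>f\<close> are strict.
\<close>
lemma interior_scaling_limitsD:
  assumes f: "f \<in> D_topology interior_of scaling_limits"
  shows "f 0 < 1" "0 < f 1" "\<And>x. x \<in> {0<..1} \<Longrightarrow> 0 < eg_gap f x"
proof -
  obtain r where fD: "f \<in> D_space" and r: "0 < r" "\<And>g. g \<in> D_space \<Longrightarrow> dist1' f g < r \<Longrightarrow> g \<in> scaling_limits"
    using f by (auto simp: in_interior_iff)
  have raise: "raise c x f \<in> scaling_limits" if "\<bar>c\<bar> < r / 3" "0 \<le> c \<or> x = 1" for c x
    using dist1'_raise[OF fD that(2)] that(1) by (intro r(2) raise_in_D_space[OF fD that(2)]) auto
  show "f 0 < 1"
    using scaling_limits_bounds(1)[OF raise[of "r/4" 1]] r(1) by (simp add: raise_def)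
  show "0 < f 1"
    using scaling_limits_bounds(2)[OF raise[of "-r/4" 1]] r(1) by (simp add: raise_def)
  fix x :: real assume x: "x \<in> {0<..1}"
  have "0 \<le> eg_gap f x - r / 4 * x"
    using eg_gap_nonneg[OF raise[of "r/4" x], of x] eg_gap_raise[OF fD, of x "r/4"] r(1) x by simp
  moreover have "0 < r / 4 * x" using r(1) x by simp
  ultimately show "0 < eg_gap f x" by linarith
qed

text \<open>
The sufficient conditions of \<open>scaling_limits_if_gap_pos\<close> persist under small perturbations. The
end values control the range of a monotone function, and the gap of the perturbed function \<open>g\<close> is
positive near 0 by \<open>eg_gap_near_0\<close> and elsewhere by the uniform lower bound for \<open>f\<close>.
\<close>
lemma interior_scaling_limitsI:
  assumes f: "f \<in> D_space"
    and range: "\<And>x. x \<in> {0..1} \<Longrightarrow> c1 \<le> f x \<and> f x \<le> c2" and c: "0 < c1" "c2 < 1"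
    and pos: "\<And>x. x \<in> {0<..1} \<Longrightarrow> 0 < eg_gap f x"
  shows "f \<in> D_topology interior_of scaling_limits"
proof -
  have mono: "antimono_on {0..1} f" using f by (simp add: D_space_def)
  obtain m where m: "0 < m" "\<And>x. x \<in> {c1/2..1} \<Longrightarrow> m \<le> eg_gap f x"
    using eg_gap_bounded_below[OF mono pos, of "c1/2"] c by auto
  define r where "r = min m (min (c1 / 2) ((1 - c2) / 2))"
  have "0 < r" using m(1) c by (simp add: r_def)
  moreover have "r \<le> m \<and> r \<le> c1 / 2 \<and> r \<le> (1 - c2) / 2"
    by (metis r_def min.bounded_iff order_refl)
  ultimately have r: "0 < r" "r \<le> m" "r \<le> c1 / 2" "r \<le> (1 - c2) / 2"
    by blast+
  have "g \<in> scaling_limits" if g: "g \<in> D_space" and dist: "dist1' f g < r" for g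
  proof (rule scaling_limits_if_gap_pos[OF g])
    have gmono: "antimono_on {0..1} g" using g by (simp add: D_space_def)
    show grange: "c1 / 2 \<le> g x \<and> g x \<le> (1 + c2) / 2" if x: "x \<in> {0..1}" for x
    proof -
      have "g x \<le> g 0" "g 1 \<le> g x"
        using x by (auto intro!: monotone_onD[OF gmono])
      with dist1'_ge(1,2)[OF f g] range[of 0] range[of 1] r dist show ?thesis
        by (auto simp: field_simps)
    qed
    show "0 < eg_gap g x" if x: "x \<in> {0<..1}" for x
    proof (cases "x \<le> c1 / 2")
      case True
      have "0 < (1 - (1 + c2) / 2) * x" using c x by simp
      also have "\<dots> \<le> eg_gap g x"
        using True x by (intro eg_gap_near_0[OF gmono grange]) auto
      finally show ?thesis .
    next
      case False
      then show ?thesis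
        using m(2)[of x] eg_gap_dist[OF f g, of x] x r dist by auto
    qed
  qed (use c in auto)
  with f r(1) show ?thesis by (auto simp: in_interior_iff)
qed

theorem proposition1p2:
  fixes f :: "real \<Rightarrow> real"
  assumes "f \<in> D_space" and "f ` {0..1} \<subseteq> {0..1}"
  shows "f \<in> D_topology interior_of scaling_limits \<longleftrightarrow>
    (\<exists>c1>0. \<exists>c2<1. \<forall>x\<in>{0..1}. c1 \<le> f x \<and> f x \<le> c2) \<and>
    (\<forall>x\<in>{0<..1}. integral {x..1} (\<lambda>y. min (f y) x) + x\<^sup>2 - integral {0..x} f > 0)"
proof
  assume int: "f \<in> D_topology interior_of scaling_limits"
  have "f 1 \<le> f x \<and> f x \<le> f 0" if "x \<in> {0..1}" for x
    using assms(1) that by (auto simp: D_space_def monotone_on_def)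
  then show "(\<exists>c1>0. \<exists>c2<1. \<forall>x\<in>{0..1}. c1 \<le> f x \<and> f x \<le> c2) \<and>
    (\<forall>x\<in>{0<..1}. integral {x..1} (\<lambda>y. min (f y) x) + x\<^sup>2 - integral {0..x} f > 0)"
    using interior_scaling_limitsD[OF int] unfolding eg_gap_def by blast
next
  assume "(\<exists>c1>0. \<exists>c2<1. \<forall>x\<in>{0..1}. c1 \<le> f x \<and> f x \<le> c2) \<and>
    (\<forall>x\<in>{0<..1}. integral {x..1} (\<lambda>y. min (f y) x) + x\<^sup>2 - integral {0..x} f > 0)"
  then show "f \<in> D_topology interior_of scaling_limits"
    using interior_scaling_limitsI[OF assms(1)] unfolding eg_gap_def by blast
qed

end
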